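(* Let $(\phi^n,R^n)$ be generated by the second-order RZF-BDF2 scheme (defined in the context, with $\lambda_0,\kappa^{n+1}$ chosen at each step by the rule in the context). Then the scheme is unconditionally energy stable in the sense that, for every $\Delta t>0$ and every $n\ge1$, $$\widetilde{\mathcal{E}}(\phi^{n+1})-\widetilde{\mathcal{E}}(\phi^{n})\leq-\left(1-\tfrac32\kappa^{n+1}\right)\left[\Delta t(\mathcal{G}\mu^{n+1},\mu^{n+1})+\tfrac14\left(\mathcal{L}(\phi^{n+1}-2\phi^n+\phi^{n-1}),\phi^{n+1}-2\phi^n+\phi^{n-1}\right)\right]\leq0,$$ where $$\widetilde{\mathcal{E}}(\phi^{n+1})=\tfrac14(\mathcal{L}\phi^{n+1},\phi^{n+1})+\tfrac14\left(\mathcal{L}(2\phi^{n+1}-\phi^n),2\phi^{n+1}-\phi^n\right)+\tfrac32R^{n+1}-\tfrac12R^n$$ (and $\widetilde{\mathcal{E}}(\phi^{n})$ is the same expression with $n$ replaced by $n-1$).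
   Context: $(\cdot,\cdot)$ is the $L^2(\Omega)$ inner product (e.g. on a periodic domain $\Omega$). $\mathcal{L}$ is a symmetric non-negative linear operator, $\mathcal{G}$ is a positive linear operator in the sense that $(\mathcal{G}v,v)\ge0$ for all $v$ (e.g. $I$ or $-\Delta$), $F$ is a differentiable real function applied pointwise, $(F(\phi),1)=\int_\Omega F(\phi)\,d\mathbf{x}$, and $\Delta t>0$. All functions are assumed regular enough for every expression to be defined. $A=3I+2\Delta t\,\mathcal{G}\mathcal{L}$ is invertible. RZF-BDF2 (relaxed zero-factor, 2-step backward difference) scheme: the starting data $\phi^0,\phi^1$ and $R^0=(F(\phi^0),1)$, $R^1\in\mathbb{R}$ are given. For $n\ge1$, given $\phi^{n-1},\phi^n,R^{n-1},R^n$, let $\widehat{\phi}^{n+1}=2\phi^n-\phi^{n-1}$ and $\overline{\phi}^{n+1}=A^{-1}(4\phi^n-\phi^{n-1}-2\Delta t\,\mathcal{G}F'(\widehat{\phi}^{n+1}))$. Step I: find $\phi^{n+1},\mu^{n+1}$ and a real number $\mathcal{P}(\eta^{n+1})$ (the zero factor, a linear function of a scalar variable $\eta$; it is assumed that a solution exists at each step) with $\frac{3\phi^{n+1}-4\phi^n+\phi^{n-1}}{2\Delta t}=-\mathcal{G}\mu^{n+1}$, $\mu^{n+1}=\mathcal{L}\phi^{n+1}+[1+\mathcal{P}(\eta^{n+1})]F'(\widehat{\phi}^{n+1})$, $3\widetilde{R}^{n+1}-4R^n+R^{n-1}=[1+\mathcal{P}(\eta^{n+1})](F'(\widehat{\phi}^{n+1}),3\phi^{n+1}-4\phi^n+\phi^{n-1})$,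 where $\widetilde{R}^{n+1}=(F(\overline{\phi}^{n+1}),1)$. Step II: $R^{n+1}=\lambda_0\widetilde{R}^{n+1}+(1-\lambda_0)(F(\phi^{n+1}),1)$. Choice of $\lambda_0$ and $\kappa^{n+1}$: put $D=\Delta t(\mathcal{G}\mu^{n+1},\mu^{n+1})+\frac14(\mathcal{L}(\phi^{n+1}-2\phi^n+\phi^{n-1}),\phi^{n+1}-2\phi^n+\phi^{n-1})$ and, when $\widetilde{R}^{n+1}\ne(F(\phi^{n+1}),1)$, $\beta=\frac{D}{|\widetilde{R}^{n+1}-(F(\phi^{n+1}),1)|}$. (1) If $\widetilde{R}^{n+1}\geq(F(\phi^{n+1}),1)$, $\lambda_0=0$ and $\kappa^{n+1}=0$. (2) If $\widetilde{R}^{n+1}<(F(\phi^{n+1}),1)$ and $\beta\geq\frac32$, $\lambda_0=0$ and $\kappa^{n+1}=\frac1\beta$. (3) If $\widetilde{R}^{n+1}<(F(\phi^{n+1}),1)$ and $\beta\in[0,\frac32)$, $\lambda_0=1-\frac23\beta$ and $\kappa^{n+1}=\frac23$. *)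

theory Defs
  imports "HOL-Analysis.Analysis"
begin

definition L2 :: "'a::euclidean_space set \<Rightarrow> ('a \<Rightarrow> real) set" where
  "L2 \<Omega> = {u \<in> borel_measurable (lebesgue_on \<Omega>). integrable (lebesgue_on \<Omega>) (\<lambda>x. (u x)\<^sup>2)}"

definition ae_eq :: "'a::euclidean_space set \<Rightarrow> ('a \<Rightarrow> real) \<Rightarrow> ('a \<Rightarrow> real) \<Rightarrow> bool" where
  "ae_eq \<Omega> u v \<longleftrightarrow> (AE x in lebesgue_on \<Omega>. u x = v x)"

definition l2_inner :: "'a::euclidean_space set \<Rightarrow> ('a \<Rightarrow> real) \<Rightarrow> ('a \<Rightarrow> real) \<Rightarrow> real" where
  "l2_inner \<Omega> u v = integral\<^sup>L (lebesgue_on \<Omega>) (\<lambda>x. u x * v x)"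

text \<open>A possibly unbounded linear operator \<open>T\<close> in \<open>L\<^sup>2(\<Omega>)\<close> with domain \<open>D\<close>, given on
  representatives. Elements of \<open>L\<^sup>2(\<Omega>)\<close> are functions up to null sets, so \<open>D\<close> is a union of
  equivalence classes and all identities between functions are understood almost everywhere.\<close>

definition L2_operator ::
  "'a::euclidean_space set \<Rightarrow> ('a \<Rightarrow> real) set \<Rightarrow> (('a \<Rightarrow> real) \<Rightarrow> ('a \<Rightarrow> real)) \<Rightarrow> bool" where
  "L2_operator \<Omega> D T \<longleftrightarrow>
     D \<subseteq> L2 \<Omega> \<and> (\<lambda>x. 0) \<in> D \<and> T ` D \<subseteq> L2 \<Omega> \<and>
     (\<forall>u\<in>D. \<forall>v\<in>L2 \<Omega>. ae_eq \<Omega> u v \<longrightarrow> v \<in> D \<and> ae_eq \<Omega> (T u) (T v)) \<and>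
     (\<forall>u\<in>D. \<forall>v\<in>D. \<forall>a b. (\<lambda>x. a * u x + b * v x) \<in> D \<and>
        ae_eq \<Omega> (T (\<lambda>x. a * u x + b * v x)) (\<lambda>x. a * T u x + b * T v x))"

definition symmetric_operator ::
  "'a::euclidean_space set \<Rightarrow> ('a \<Rightarrow> real) set \<Rightarrow> (('a \<Rightarrow> real) \<Rightarrow> ('a \<Rightarrow> real)) \<Rightarrow> bool" where
  "symmetric_operator \<Omega> D T \<longleftrightarrow> (\<forall>u\<in>D. \<forall>v\<in>D. l2_inner \<Omega> (T u) v = l2_inner \<Omega> u (T v))"

definition nonneg_operator ::
  "'a::euclidean_space set \<Rightarrow> ('a \<Rightarrow> real) set \<Rightarrow> (('a \<Rightarrow> real) \<Rightarrow> ('a \<Rightarrow> real)) \<Rightarrow> bool" where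
  "nonneg_operator \<Omega> D T \<longleftrightarrow> (\<forall>u\<in>D. l2_inner \<Omega> (T u) u \<ge> 0)"

definition invertible_operator ::
  "'a::euclidean_space set \<Rightarrow> ('a \<Rightarrow> real) set \<Rightarrow> (('a \<Rightarrow> real) \<Rightarrow> ('a \<Rightarrow> real)) \<Rightarrow> bool" where
  "invertible_operator \<Omega> D T \<longleftrightarrow>
     (\<forall>f\<in>L2 \<Omega>. \<exists>u\<in>D. ae_eq \<Omega> (T u) f) \<and>
     (\<forall>u\<in>D. \<forall>v\<in>D. ae_eq \<Omega> (T u) (T v) \<longrightarrow> ae_eq \<Omega> u v)"

text \<open>The operator \<open>A = 3I + 2\<Delta>t G L\<close> on its natural domain.\<close>

definition A_dom ::
  "('a \<Rightarrow> real) set \<Rightarrow> (('a \<Rightarrow> real) \<Rightarrow> ('a \<Rightarrow> real)) \<Rightarrow> ('a \<Rightarrow> real) set \<Rightarrow> ('a \<Rightarrow> real) set" where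
  "A_dom DL L DG = {u \<in> DL. L u \<in> DG}"

definition A_op ::
  "(('a \<Rightarrow> real) \<Rightarrow> ('a \<Rightarrow> real)) \<Rightarrow> (('a \<Rightarrow> real) \<Rightarrow> ('a \<Rightarrow> real)) \<Rightarrow> real \<Rightarrow>
   ('a \<Rightarrow> real) \<Rightarrow> ('a \<Rightarrow> real)" where
  "A_op L G dt u = (\<lambda>x. 3 * u x + 2 * dt * G (L u) x)"

text \<open>The extrapolation \<open>2\<phi>\<^sup>n - \<phi>\<^sup>n\<^sup>-\<^sup>1\<close>; it is used at level \<open>n + 1\<close>.\<close>

definition phi_hat :: "(nat \<Rightarrow> 'a \<Rightarrow> real) \<Rightarrow> nat \<Rightarrow> 'a \<Rightarrow> real" where
  "phi_hat \<phi> n = (\<lambda>x. 2 * \<phi> n x - \<phi> (n - 1) x)"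

definition bdf2_diff :: "(nat \<Rightarrow> 'a \<Rightarrow> real) \<Rightarrow> nat \<Rightarrow> 'a \<Rightarrow> real" where
  "bdf2_diff \<phi> n = (\<lambda>x. 3 * \<phi> (n + 1) x - 4 * \<phi> n x + \<phi> (n - 1) x)"

definition second_diff :: "(nat \<Rightarrow> 'a \<Rightarrow> real) \<Rightarrow> nat \<Rightarrow> 'a \<Rightarrow> real" where
  "second_diff \<phi> n = (\<lambda>x. \<phi> (n + 1) x - 2 * \<phi> n x + \<phi> (n - 1) x)"

definition nonlinear_energy ::
  "'a::euclidean_space set \<Rightarrow> (real \<Rightarrow> real) \<Rightarrow> ('a \<Rightarrow> real) \<Rightarrow> real" where
  "nonlinear_energy \<Omega> F u = l2_inner \<Omega> (\<lambda>x. F (u x)) (\<lambda>x. 1)"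

definition dissipation ::
  "'a::euclidean_space set \<Rightarrow> (('a \<Rightarrow> real) \<Rightarrow> ('a \<Rightarrow> real)) \<Rightarrow> (('a \<Rightarrow> real) \<Rightarrow> ('a \<Rightarrow> real)) \<Rightarrow> real \<Rightarrow>
   (nat \<Rightarrow> 'a \<Rightarrow> real) \<Rightarrow> (nat \<Rightarrow> 'a \<Rightarrow> real) \<Rightarrow> nat \<Rightarrow> real" where
  "dissipation \<Omega> L G dt \<phi> \<mu> n =
     dt * l2_inner \<Omega> (G (\<mu> (n + 1))) (\<mu> (n + 1))
     + 1/4 * l2_inner \<Omega> (L (second_diff \<phi> n)) (second_diff \<phi> n)"

text \<open>The choice of the relaxation parameter \<open>lam\<close> and of \<open>kap\<close> from the dissipation \<open>D\<close>, the
  auxiliary value \<open>Rt\<close> and the nonlinear energy \<open>E\<close> of the new solution. For \<open>D \<ge> 0\<close> the three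
  cases are exhaustive and mutually exclusive.\<close>

definition relaxation_rule :: "real \<Rightarrow> real \<Rightarrow> real \<Rightarrow> real \<Rightarrow> real \<Rightarrow> bool" where
  "relaxation_rule D Rt E lam kap \<longleftrightarrow>
     (let \<beta> = D / \<bar>Rt - E\<bar> in
       (Rt \<ge> E \<longrightarrow> lam = 0 \<and> kap = 0) \<and>
       (Rt < E \<and> \<beta> \<ge> 3/2 \<longrightarrow> lam = 0 \<and> kap = 1 / \<beta>) \<and>
       (Rt < E \<and> 0 \<le> \<beta> \<and> \<beta> < 3/2 \<longrightarrow> lam = 1 - 2/3 * \<beta> \<and> kap = 2/3))"

text \<open>One step from levels \<open>n - 1\<close>, \<open>n\<close> to level \<open>n + 1\<close>, for \<open>n \<ge> 1\<close>. The first six conjuncts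
  are the regularity needed for the remaining ones to be meaningful; the condition on
  \<open>\<phi>bar (n + 1)\<close> says that it is the image under the inverse of \<open>A\<close> of the right-hand side.\<close>

definition rzf_bdf2_step where
  "rzf_bdf2_step (\<Omega> :: 'a::euclidean_space set) DL L DG G F P dt
     (\<phi> :: nat \<Rightarrow> 'a \<Rightarrow> real) \<mu> \<eta> \<phi>bar Rt R lam kap n \<longleftrightarrow>
     \<phi> (n + 1) \<in> DL \<and> \<mu> (n + 1) \<in> DG \<and> \<phi>bar (n + 1) \<in> A_dom DL L DG \<and>
     (\<lambda>x. deriv F (phi_hat \<phi> n x)) \<in> DG \<and>
     integrable (lebesgue_on \<Omega>) (\<lambda>x. F (\<phi>bar (n + 1) x)) \<and>
     integrable (lebesgue_on \<Omega>) (\<lambda>x. F (\<phi> (n + 1) x)) \<and>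
     ae_eq \<Omega> (A_op L G dt (\<phi>bar (n + 1)))
       (\<lambda>x. 4 * \<phi> n x - \<phi> (n - 1) x - 2 * dt * G (\<lambda>y. deriv F (phi_hat \<phi> n y)) x) \<and>
     ae_eq \<Omega> (\<lambda>x. bdf2_diff \<phi> n x / (2 * dt)) (\<lambda>x. - G (\<mu> (n + 1)) x) \<and>
     ae_eq \<Omega> (\<mu> (n + 1))
       (\<lambda>x. L (\<phi> (n + 1)) x + (1 + P (\<eta> (n + 1))) * deriv F (phi_hat \<phi> n x)) \<and>
     Rt (n + 1) = nonlinear_energy \<Omega> F (\<phi>bar (n + 1)) \<and>
     3 * Rt (n + 1) - 4 * R n + R (n - 1) =
       (1 + P (\<eta> (n + 1))) * l2_inner \<Omega> (\<lambda>x. deriv F (phi_hat \<phi> n x)) (bdf2_diff \<phi> n) \<and>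
     R (n + 1) = lam (n + 1) * Rt (n + 1)
       + (1 - lam (n + 1)) * nonlinear_energy \<Omega> F (\<phi> (n + 1)) \<and>
     relaxation_rule (dissipation \<Omega> L G dt \<phi> \<mu> n) (Rt (n + 1))
       (nonlinear_energy \<Omega> F (\<phi> (n + 1))) (lam (n + 1)) (kap (n + 1))"

text \<open>\<open>R 1\<close> is an arbitrary given number.\<close>

definition rzf_bdf2 where
  "rzf_bdf2 (\<Omega> :: 'a::euclidean_space set) DL L DG G F P dt \<phi> \<mu> \<eta> \<phi>bar Rt R lam kap \<longleftrightarrow>
     \<phi> 0 \<in> DL \<and> \<phi> 1 \<in> DL \<and> integrable (lebesgue_on \<Omega>) (\<lambda>x. F (\<phi> 0 x)) \<and>
     R 0 = nonlinear_energy \<Omega> F (\<phi> 0) \<and>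
     (\<forall>n\<ge>1. rzf_bdf2_step \<Omega> DL L DG G F P dt \<phi> \<mu> \<eta> \<phi>bar Rt R lam kap n)"

text \<open>The modified energy at level \<open>m \<ge> 1\<close>.\<close>

definition modified_energy ::
  "'a::euclidean_space set \<Rightarrow> (('a \<Rightarrow> real) \<Rightarrow> ('a \<Rightarrow> real)) \<Rightarrow> (nat \<Rightarrow> 'a \<Rightarrow> real) \<Rightarrow>
   (nat \<Rightarrow> real) \<Rightarrow> nat \<Rightarrow> real" where
  "modified_energy \<Omega> L \<phi> R m =
     1/4 * l2_inner \<Omega> (L (\<phi> m)) (\<phi> m)
     + 1/4 * l2_inner \<Omega> (L (\<lambda>x. 2 * \<phi> m x - \<phi> (m - 1) x)) (\<lambda>x. 2 * \<phi> m x - \<phi> (m - 1) x)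
     + 3/2 * R m - 1/2 * R (m - 1)"

end

theory Submission
  imports Defs
begin

text \<open>Testing the \<open>\<phi>\<close>-equation with \<open>\<mu>\<^sup>n\<^sup>+\<^sup>1\<close> and inserting the other two equations of Step I turns the
  BDF2 identity for the form \<open>(Lu, v)\<close> into an exact energy balance with \<open>Rt\<^sup>n\<^sup>+\<^sup>1\<close> in place of \<open>R\<^sup>n\<^sup>+\<^sup>1\<close>.
  Restoring \<open>R\<^sup>n\<^sup>+\<^sup>1\<close> costs \<open>3/2 (1 - lam) ((F(\<phi>\<^sup>n\<^sup>+\<^sup>1), 1) - Rt\<^sup>n\<^sup>+\<^sup>1)\<close>, and the rule for \<open>lam\<close> and \<open>kap\<^sup>n\<^sup>+\<^sup>1\<close> is
  designed so that this is at most \<open>3/2 kap\<^sup>n\<^sup>+\<^sup>1 D\<close> with \<open>3/2 kap\<^sup>n\<^sup>+\<^sup>1 \<le> 1\<close>.\<close>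

lemma L2_integrable_mult:
  assumes "u \<in> L2 \<Omega>" and "v \<in> L2 \<Omega>"
  shows "integrable (lebesgue_on \<Omega>) (\<lambda>x. u x * v x)"
proof (rule Bochner_Integration.integrable_bound)
  show "integrable (lebesgue_on \<Omega>) (\<lambda>x. (u x)\<^sup>2 + (v x)\<^sup>2)"
    using assms by (auto simp: L2_def)
  show "(\<lambda>x. u x * v x) \<in> borel_measurable (lebesgue_on \<Omega>)"
    using assms by (auto simp: L2_def)
  have "\<bar>a * b\<bar> \<le> a\<^sup>2 + b\<^sup>2" for a b :: real
  proof -
    have "2 * (\<bar>a\<bar> * \<bar>b\<bar>) \<le> a\<^sup>2 + b\<^sup>2"
      using sum_squares_bound[of "\<bar>a\<bar>" "\<bar>b\<bar>"] by simp
    moreover have "0 \<le> \<bar>a\<bar> * \<bar>b\<bar>" by simp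
    ultimately show ?thesis unfolding abs_mult by linarith
  qed
  then show "AE x in lebesgue_on \<Omega>. norm (u x * v x) \<le> norm ((u x)\<^sup>2 + (v x)\<^sup>2)"
    by simp
qed

lemma l2_inner_commute: "l2_inner \<Omega> u v = l2_inner \<Omega> v u"
  by (simp add: l2_inner_def mult.commute)

text \<open>Three terms match the three time levels of the BDF2 stencil; shorter combinations are
  instances with zero coefficients. Membership in \<open>L2\<close> makes each product integrable,
  so the integral splits.\<close>

lemma l2_inner_lincomb_left:
  assumes "u \<in> L2 \<Omega>" "v \<in> L2 \<Omega>" "w \<in> L2 \<Omega>" "z \<in> L2 \<Omega>"
  shows "l2_inner \<Omega> (\<lambda>x. a * u x + b * v x + c * w x) z =
    a * l2_inner \<Omega> u z + b * l2_inner \<Omega> v z + c * l2_inner \<Omega> w z"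
proof -
  have "(a * u x + b * v x + c * w x) * z x =
      a * (u x * z x) + b * (v x * z x) + c * (w x * z x)" for x
    by (simp add: algebra_simps)
  then show ?thesis
    using assms by (simp add: l2_inner_def L2_integrable_mult)
qed

lemma l2_inner_cong_AE:
  assumes "ae_eq \<Omega> u v" and "u \<in> borel_measurable (lebesgue_on \<Omega>)"
    and "v \<in> borel_measurable (lebesgue_on \<Omega>)" and "w \<in> borel_measurable (lebesgue_on \<Omega>)"
  shows "l2_inner \<Omega> u w = l2_inner \<Omega> v w"
  unfolding l2_inner_def
proof (rule integral_cong_AE)
  show "AE x in lebesgue_on \<Omega>. u x * w x = v x * w x"
    using assms(1) unfolding ae_eq_def by (rule AE_mp) simp
qed (use assms in auto)

lemma L2_operator_lincomb:
  assumes T: "L2_operator \<Omega> D T" and "u \<in> D" "v \<in> D" "w \<in> D"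
  shows "(\<lambda>x. a * u x + b * v x + c * w x) \<in> D"
proof -
  have lin: "(\<lambda>x. a * u x + b * v x) \<in> D" if "u \<in> D" "v \<in> D" for u v a b
    using T that unfolding L2_operator_def by blast
  have "(\<lambda>x. 1 * (a * u x + b * v x) + c * w x) \<in> D"
    using lin[of "\<lambda>x. a * u x + b * v x" w 1 c] lin assms(2-4) by blast
  then show ?thesis by simp
qed

lemma L2_operator_L2:
  assumes "L2_operator \<Omega> D T" and "u \<in> D"
  shows "u \<in> L2 \<Omega>" and "T u \<in> L2 \<Omega>"
  using assms unfolding L2_operator_def by auto

context
  fixes \<Omega> :: "'a::euclidean_space set" and D :: "('a \<Rightarrow> real) set"
    and T :: "('a \<Rightarrow> real) \<Rightarrow> ('a \<Rightarrow> real)"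
  assumes T: "L2_operator \<Omega> D T" and sym: "symmetric_operator \<Omega> D T"
begin

lemma symmetric_form_commute:
  assumes "u \<in> D" "v \<in> D"
  shows "l2_inner \<Omega> (T u) v = l2_inner \<Omega> (T v) u"
  using sym assms unfolding symmetric_operator_def by (metis l2_inner_commute)

lemma symmetric_form_lincomb:
  assumes "u \<in> D" "v \<in> D" "w \<in> D" "z \<in> D"
  shows "l2_inner \<Omega> (T z) (\<lambda>x. a * u x + b * v x + c * w x) =
    a * l2_inner \<Omega> (T z) u + b * l2_inner \<Omega> (T z) v + c * l2_inner \<Omega> (T z) w"
  using l2_inner_lincomb_left[of u \<Omega> v w "T z"] L2_operator_L2[OF T] assms
  by (simp add: l2_inner_commute[of _ "T z"])

text \<open>Symmetry trades \<open>T z\<close> for \<open>T u\<close>, \<open>T v\<close>,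
  \<open>T w\<close>, so the expansion takes place in the inner product, as an exact equality of
  numbers, rather than under \<open>T\<close>, where identities hold only almost everywhere.\<close>

lemma symmetric_form_square:
  fixes a b c :: real
  assumes "u \<in> D" "v \<in> D" "w \<in> D"
  defines "z \<equiv> (\<lambda>x. a * u x + b * v x + c * w x)"
  shows "l2_inner \<Omega> (T z) z =
    a\<^sup>2 * l2_inner \<Omega> (T u) u + b\<^sup>2 * l2_inner \<Omega> (T v) v + c\<^sup>2 * l2_inner \<Omega> (T w) w
    + 2 * a * b * l2_inner \<Omega> (T u) v + 2 * a * c * l2_inner \<Omega> (T u) w
    + 2 * b * c * l2_inner \<Omega> (T v) w"
proof -
  have z: "z \<in> D"
    unfolding z_def using L2_operator_lincomb[OF T] assms(1-3) by blast
  have row: "l2_inner \<Omega> (T z) y =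
      a * l2_inner \<Omega> (T y) u + b * l2_inner \<Omega> (T y) v + c * l2_inner \<Omega> (T y) w"
    if "y \<in> D" for y
    using symmetric_form_commute[OF z that] symmetric_form_lincomb[OF assms(1-3) that]
    unfolding z_def by simp
  have "l2_inner \<Omega> (T z) z =
      a * l2_inner \<Omega> (T z) u + b * l2_inner \<Omega> (T z) v + c * l2_inner \<Omega> (T z) w"
    using symmetric_form_lincomb[OF assms(1-3) z] unfolding z_def by simp
  then show ?thesis
    unfolding row[OF assms(1)] row[OF assms(2)] row[OF assms(3)]
      symmetric_form_commute[OF assms(2,1)] symmetric_form_commute[OF assms(3,1)]
      symmetric_form_commute[OF assms(3,2)]
    by (simp add: algebra_simps power2_eq_square)
qed

text \<open>This is 2a(3a - 4b + c) = a^2 + (2a - b)^2 - b^2 - (2b - c)^2 + (a - 2b + c)^2 read for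
  a symmetric form: both sides are expanded in the values of the form on \<open>u\<close>,
  \<open>v\<close>, \<open>w\<close> and compared.\<close>

lemma bdf2_identity:
  assumes "u \<in> D" "v \<in> D" "w \<in> D"
  shows "2 * l2_inner \<Omega> (T u) (\<lambda>x. 3 * u x - 4 * v x + w x) =
    l2_inner \<Omega> (T u) u + l2_inner \<Omega> (T (\<lambda>x. 2 * u x - v x)) (\<lambda>x. 2 * u x - v x)
    - l2_inner \<Omega> (T v) v - l2_inner \<Omega> (T (\<lambda>x. 2 * v x - w x)) (\<lambda>x. 2 * v x - w x)
    + l2_inner \<Omega> (T (\<lambda>x. u x - 2 * v x + w x)) (\<lambda>x. u x - 2 * v x + w x)"
  using symmetric_form_lincomb[OF assms assms(1), of 3 "-4" 1]
    symmetric_form_square[OF assms, of 2 "-1" 0] symmetric_form_square[OF assms, of 0 2 "-1"]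
    symmetric_form_square[OF assms, of 1 "-2" 1]
  by (simp add: algebra_simps)

end

text \<open>If \<open>Rt \<ge> E\<close>, the left side of the first bound is \<open>E - Rt\<close>,
  hence nonpositive, and \<open>kap = 0\<close>. Otherwise \<open>D = \<beta> * (E - Rt)\<close>,
  and both remaining choices of \<open>lam\<close> and \<open>kap\<close> turn the first bound into
  an equality; in the last one the factor \<open>1 - 3/2 * kap\<close> vanishes.\<close>

lemma relaxation_rule_bound:
  assumes "relaxation_rule D Rt E lam kap" and "D \<ge> 0"
  shows "(1 - lam) * (E - Rt) \<le> kap * D" and "0 \<le> (1 - 3/2 * kap) * D"
proof -
  define \<beta> where "\<beta> = D / \<bar>Rt - E\<bar>"
  note rule = assms(1)[unfolded relaxation_rule_def Let_def, folded \<beta>_def]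
  \<comment> \<open>This covers \<open>Rt = E\<close> too, where division by zero yields 0; the rule
    consults \<open>\<beta>\<close> only for \<open>Rt < E\<close>.\<close>
  have "\<beta> \<ge> 0" using assms(2) by (simp add: \<beta>_def)
  then consider "Rt \<ge> E" | "Rt < E" "\<beta> \<ge> 3/2" | "Rt < E" "0 \<le> \<beta>" "\<beta> < 3/2"
    by linarith
  then have "(1 - lam) * (E - Rt) \<le> kap * D \<and> 0 \<le> (1 - 3/2 * kap) * D"
  proof cases
    case 1
    then show ?thesis using rule assms(2) by auto
  next
    case 2
    then have D: "D = \<beta> * (E - Rt)" by (simp add: \<beta>_def)
    have "lam = 0" "kap = 1 / \<beta>" using rule 2 by auto
    \<comment> \<open>The threshold 3/2 for \<open>\<beta>\<close> is exactly what keeps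
      \<open>1 - 3/2 * kap\<close> nonnegative.\<close>
    moreover have "kap \<le> 2/3"
      unfolding \<open>kap = 1 / \<beta>\<close> using 2 by (simp add: divide_simps)
    ultimately show ?thesis using 2 assms(2) by (simp add: D)
  next
    case 3
    then have D: "D = \<beta> * (E - Rt)" by (simp add: \<beta>_def)
    have lam: "lam = 1 - 2/3 * \<beta>" and kap: "kap = 2/3" using rule 3 by auto
    show ?thesis unfolding lam kap by (simp add: D)
  qed
  then show "(1 - lam) * (E - Rt) \<le> kap * D" and "0 \<le> (1 - 3/2 * kap) * D"
    by blast+
qed

theorem theorem3p4:
  fixes \<Omega> :: "'a::euclidean_space set"
    and DL DG :: "('a \<Rightarrow> real) set"
    and L G :: "('a \<Rightarrow> real) \<Rightarrow> ('a \<Rightarrow> real)"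
    and F P :: "real \<Rightarrow> real"
    and dt :: real
    and \<phi> \<mu> \<phi>bar :: "nat \<Rightarrow> 'a \<Rightarrow> real"
    and \<eta> Rt R lam kap :: "nat \<Rightarrow> real"
    and n :: nat
  assumes "\<Omega> \<in> sets lebesgue"
    and "L2_operator \<Omega> DL L" and "symmetric_operator \<Omega> DL L" and "nonneg_operator \<Omega> DL L"
    and "L2_operator \<Omega> DG G" and "nonneg_operator \<Omega> DG G"
    and "\<And>s. F field_differentiable (at s)"
    and "\<exists>a b. \<forall>s. P s = a * s + b"
    and "dt > 0"
    and "invertible_operator \<Omega> (A_dom DL L DG) (A_op L G dt)"
    and "rzf_bdf2 \<Omega> DL L DG G F P dt \<phi> \<mu> \<eta> \<phi>bar Rt R lam kap"
    and "n \<ge> 1"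
  shows "modified_energy \<Omega> L \<phi> R (n + 1) - modified_energy \<Omega> L \<phi> R n
           \<le> - (1 - 3/2 * kap (n + 1)) * dissipation \<Omega> L G dt \<phi> \<mu> n
       \<and> - (1 - 3/2 * kap (n + 1)) * dissipation \<Omega> L G dt \<phi> \<mu> n \<le> 0"
proof -
  note L = assms(2) and sym = assms(3) and G = assms(5)
  have step: "rzf_bdf2_step \<Omega> DL L DG G F P dt \<phi> \<mu> \<eta> \<phi>bar Rt R lam kap m"
    if "m \<ge> 1" for m
    using assms(11) that unfolding rzf_bdf2_def by blast
  have \<phi>: "\<phi> m \<in> DL" for m
  proof (cases "m \<le> 1")
    case True
    then have "m = 0 \<or> m = 1" by linarith
    then show ?thesis using assms(11) unfolding rzf_bdf2_def by auto
  next
    case False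
    then show ?thesis using step[of "m - 1"] unfolding rzf_bdf2_step_def by auto
  qed
  let ?a = "\<phi> (n + 1)" and ?b = "\<phi> n" and ?c = "\<phi> (n - 1)" and ?m = "\<mu> (n + 1)"
  let ?w = "bdf2_diff \<phi> n" and ?f = "\<lambda>x. deriv F (phi_hat \<phi> n x)"
  let ?s = "1 + P (\<eta> (n + 1))" and ?D = "dissipation \<Omega> L G dt \<phi> \<mu> n"
  let ?E = "nonlinear_energy \<Omega> F (\<phi> (n + 1))"
  have m: "?m \<in> DG" and f: "?f \<in> DG"
    and phi_eq: "ae_eq \<Omega> (\<lambda>x. ?w x / (2 * dt)) (\<lambda>x. - G ?m x)"
    and mu_eq: "ae_eq \<Omega> ?m (\<lambda>x. L ?a x + ?s * ?f x)"
    and R_eq: "3 * Rt (n + 1) - 4 * R n + R (n - 1) = ?s * l2_inner \<Omega> ?f ?w"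
    and R_relax: "R (n + 1) = lam (n + 1) * Rt (n + 1) + (1 - lam (n + 1)) * ?E"
    and rule: "relaxation_rule ?D (Rt (n + 1)) ?E (lam (n + 1)) (kap (n + 1))"
    using step[OF assms(12)] unfolding rzf_bdf2_step_def by auto
  have w: "?w \<in> DL"
    using L2_operator_lincomb[OF L \<phi> \<phi> \<phi>, of 3 "n + 1" "-4" n 1 "n - 1"]
    by (simp add: bdf2_diff_def)
  have d: "second_diff \<phi> n \<in> DL"
    using L2_operator_lincomb[OF L \<phi> \<phi> \<phi>, of 1 "n + 1" "-2" n 1 "n - 1"]
    by (simp add: second_diff_def)
  note L2s = L2_operator_L2[OF L w] L2_operator_L2[OF L \<phi>[of "n + 1"]]
    L2_operator_L2[OF G m] L2_operator_L2[OF G f]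
  \<comment> \<open>Exchanging almost everywhere equal functions under the integral requires
    measurability of both.\<close>
  note meas = L2s[unfolded L2_def, simplified, THEN conjunct1]

  have "ae_eq \<Omega> ?w (\<lambda>x. - 2 * dt * G ?m x)"
    using phi_eq unfolding ae_eq_def
  proof (rule AE_mp, intro AE_I2 impI)
    fix x assume "?w x / (2 * dt) = - G ?m x"
    then have "?w x = 2 * dt * (- G ?m x)"
      using assms(9) by (simp add: field_simps)
    then show "?w x = - 2 * dt * G ?m x" by simp
  qed
  then have "l2_inner \<Omega> ?w ?m = l2_inner \<Omega> (\<lambda>x. - 2 * dt * G ?m x) ?m"
    by (rule l2_inner_cong_AE) (use meas in auto)
  also have "\<dots> = - 2 * dt * l2_inner \<Omega> (G ?m) ?m"
    using l2_inner_lincomb_left[of "G ?m" \<Omega> "G ?m" "G ?m" ?m "- 2 * dt" 0 0] L2s by simp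
  finally have w_mu: "l2_inner \<Omega> ?w ?m = - 2 * dt * l2_inner \<Omega> (G ?m) ?m" .
  have "l2_inner \<Omega> ?m ?w = l2_inner \<Omega> (\<lambda>x. L ?a x + ?s * ?f x) ?w"
    by (rule l2_inner_cong_AE[OF mu_eq]) (use meas in auto)
  also have "\<dots> = l2_inner \<Omega> (L ?a) ?w + ?s * l2_inner \<Omega> ?f ?w"
    using l2_inner_lincomb_left[of "L ?a" \<Omega> ?f ?f ?w 1 ?s 0] L2s by simp
  \<comment> \<open>The pairing of \<open>?m\<close> with \<open>?w\<close> has been computed twice,
    from the equation for \<phi> and from that for \<mu>; the equation for \<open>Rt\<close>
    replaces the nonlinear term, whose factor \<open>?s\<close> is the same.\<close>
  finally have tested:
    "- 2 * dt * l2_inner \<Omega> (G ?m) ?m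
       = l2_inner \<Omega> (L ?a) ?w + (3 * Rt (n + 1) - 4 * R n + R (n - 1))"
    using w_mu R_eq l2_inner_commute[of \<Omega> ?m ?w] by linarith
  \<comment> \<open>Half of \<open>tested\<close> plus a quarter of the BDF2 identity. The weights
    3/2 and -1/2 make the \<open>R\<close> part of the energy difference half of
    \<open>3 * R (n + 1) - 4 * R n + R (n - 1)\<close>, so having \<open>Rt (n + 1)\<close> in the
    scheme leaves the defect 3/2 of \<open>R (n + 1) - Rt (n + 1)\<close>.\<close>
  have balance: "modified_energy \<Omega> L \<phi> R (n + 1) - modified_energy \<Omega> L \<phi> R n
      = - ?D + 3/2 * (R (n + 1) - Rt (n + 1))"
    using bdf2_identity[OF L sym \<phi> \<phi> \<phi>, of "n + 1" n "n - 1"] tested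
    unfolding modified_energy_def dissipation_def second_diff_def bdf2_diff_def
    by (simp add: algebra_simps)
  have relax: "R (n + 1) - Rt (n + 1) = (1 - lam (n + 1)) * (?E - Rt (n + 1))"
    unfolding R_relax by (simp add: algebra_simps)
  have D: "?D \<ge> 0"
    using assms(4,6,9) m d unfolding nonneg_operator_def dissipation_def by simp
  have "R (n + 1) - Rt (n + 1) \<le> kap (n + 1) * ?D"
    unfolding relax by (rule relaxation_rule_bound(1)[OF rule D])
  then have "modified_energy \<Omega> L \<phi> R (n + 1) - modified_energy \<Omega> L \<phi> R n
      \<le> - ?D + 3/2 * (kap (n + 1) * ?D)"
    unfolding balance by simp
  also have "\<dots> = - (1 - 3/2 * kap (n + 1)) * ?D"
    by (simp add: left_diff_distrib)
  finally have "modified_energy \<Omega> L \<phi> R (n + 1) - modified_energy \<Omega> L \<phi> R n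
      \<le> - (1 - 3/2 * kap (n + 1)) * ?D" .
  moreover have "- (1 - 3/2 * kap (n + 1)) * ?D \<le> 0"
    using relaxation_rule_bound(2)[OF rule D] unfolding mult_minus_left neg_le_0_iff_le .
  ultimately show ?thesis ..
qed

end
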